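(* Let $S$ be a finite set of integers and let $\omega \in S^{\mathbb{N}}$ be an infinite word over $S$. Then the additive complexity $\rho_\omega^{\Sigma}(n)$ of $\omega$ is bounded if and only if $\mathrm{slope}(\omega)$ exists and there is $M \in \mathbb{N}$ such that for every nonempty factor $B$ of $\omega$, $$|\mathrm{slope}(B) - \mathrm{slope}(\omega)| \leq \frac{M}{|B|}.$$
   Context: $\mathbb{N}$ denotes the positive integers. Alphabets are finite sets of integers. An infinite word over $S$ is a sequence $\omega = x_1x_2x_3\cdots$ with $x_i \in S$; $S^{\mathbb{N}}$ is the set of these. For $m \le n$, $\omega[m,n] = x_m x_{m+1}\cdots x_n$; the nonempty factors of $\omega$ are the finite words of this form. $|B|$ is the length of a finite word $B$, and if $B = y_1\cdots y_n$ then $\sum B = y_1+\cdots+y_n$. $\mathcal{F}^n(\omega)$ is the set of factors of $\omega$ of length $n$. The additive complexity of $\omega$ is $\rho_\omega^{\Sigma}(n) = |\{\sum B : B \in \mathcal{F}^n(\omega)\}|$; it is bounded if there is $M\in\mathbb{N}$ with $\rho_\omega^{\Sigma}(n) \le M$ for all $n\in\mathbb{N}$. For a nonempty finite word $B$, $\mathrm{slope}(B) = \frac{1}{|B|}\sum B$; for an infinite word, $\mathrm{slope}(\omega) = \lim_{n\to\infty} \mathrm{slope}(\omega[1,n])$, if this limit exists (in $\mathbb{R}$). *)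

theory Defs
  imports "HOL-Analysis.Analysis" "HOL-Library.Omega_Words_Fun"
begin

text \<open>
  An infinite word \<open>x\<^sub>1 x\<^sub>2 x\<^sub>3 \<dots>\<close> is a library \<open>\<omega>\<close>-word, indexed from \<open>0\<close>: the letter \<open>x\<^sub>i\<close> is
  \<open>\<omega> (i - 1)\<close>.  Since \<open>\<omega> [i \<rightarrow> j]\<close> is half-open, the factor \<open>x\<^sub>m \<dots> x\<^sub>n\<close> is \<open>\<omega> [m - 1 \<rightarrow> n]\<close>, and
  \<open>x\<^sub>1 \<dots> x\<^sub>n\<close> is \<open>prefix n \<omega>\<close>.
\<close>

definition infinite_words :: "'a set \<Rightarrow> 'a word set" where
  "infinite_words S = {\<omega>. \<forall>i. \<omega> i \<in> S}"

definition nonempty_factors :: "'a word \<Rightarrow> 'a list set" where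
  "nonempty_factors \<omega> = {\<omega> [i \<rightarrow> j] | i j. i < j}"

text \<open>The empty word is not included, so this is meant for \<open>n \<ge> 1\<close> only.\<close>

definition factors_of_length :: "nat \<Rightarrow> 'a word \<Rightarrow> 'a list set" where
  "factors_of_length n \<omega> = {B \<in> nonempty_factors \<omega>. length B = n}"

text \<open>Over a finite alphabet the set counted here is finite, so \<open>card\<close> is its true cardinality.\<close>

definition additive_complexity :: "int word \<Rightarrow> nat \<Rightarrow> nat" where
  "additive_complexity \<omega> n = card (sum_list ` factors_of_length n \<omega>)"

definition bounded_additive_complexity :: "int word \<Rightarrow> bool" where
  "bounded_additive_complexity \<omega> \<longleftrightarrow>
     (\<exists>M::nat. M \<ge> 1 \<and> (\<forall>n\<ge>1. additive_complexity \<omega> n \<le> M))"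

definition slope :: "int list \<Rightarrow> real" where
  "slope B = 1 / real (length B) * real_of_int (sum_list B)"

definition slope_exists :: "int word \<Rightarrow> bool" where
  "slope_exists \<omega> \<longleftrightarrow> convergent (\<lambda>n. slope (prefix n \<omega>))"

text \<open>Meaningful only under \<^const>\<open>slope_exists\<close>; otherwise the value is unspecified.\<close>

definition word_slope :: "int word \<Rightarrow> real" where
  "word_slope \<omega> = lim (\<lambda>n. slope (prefix n \<omega>))"

end

theory Submission
  imports Defs
begin

text \<open>
  Sliding a window of length \<open>n\<close> by one letter changes its sum by at most a constant \<open>D\<close>, so if the
  window sums take at most \<open>M\<close> values, then any two of them differ by at most \<open>M * D\<close>.  The prefix
  sums \<open>P\<close> then satisfy \<open>\<bar>P (m + n) - P m - P n\<bar> \<le> C\<close>.  Hence \<open>\<bar>P n / n - P m / m\<bar> \<le> C / n + C / m\<close>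
  by comparing both with \<open>P (m * n) / (m * n)\<close>; this gives the slope and the bound for prefixes, and
  the bound carries over to all factors at the cost of another \<open>C\<close>.  Conversely, the bound confines
  the integers \<open>\<Sum>B\<close> with \<open>\<bar>B\<bar> = n\<close> to an interval of length \<open>2 * M\<close>.
\<close>

text \<open>Cut the integers into blocks of length \<open>D\<close> starting at \<open>f i\<close>.
  The block index \<open>g\<close> moves by at most one per step, so by the discrete intermediate
  value property every block from \<open>0\<close> to \<open>g j\<close> is visited, and different
  blocks hold different values of \<open>f\<close>.\<close>

lemma oscillation_le_card_range_aux:
  fixes f :: "nat \<Rightarrow> int"
  assumes fin: "finite (range f)" and D: "D > 0" and step: "\<And>i. \<bar>f (Suc i) - f i\<bar> \<le> D"
    and "i \<le> j"
  shows "f j - f i \<le> int (card (range f)) * D"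
proof (cases "f i \<le> f j")
  case False
  then have "f j - f i \<le> 0" by simp
  also have "0 \<le> int (card (range f)) * D" using D by simp
  finally show ?thesis .
next
  case True
  define g where "g k = (f k - f i) div D" for k
  have "\<bar>g (Suc k) - g k\<bar> \<le> 1" for k
  proof -
    \<comment> \<open>Both bounds have the form \<open>c * D\<close> with \<open>c = 1\<close> or
      \<open>c = - 1\<close>, so one shift rule for \<open>div\<close> turns them into
      \<open>g k + 1\<close> and \<open>g k - 1\<close>.\<close>
    have "g (Suc k) \<le> (f k - f i + 1 * D) div D" "(f k - f i + (- 1) * D) div D \<le> g (Suc k)"
      unfolding g_def by (rule zdiv_mono1; use step[of k] D in linarith)+
    moreover have "(f k - f i + c * D) div D = c + g k" for c
      unfolding g_def using D by (intro div_mult_self1) simp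
    ultimately show ?thesis by (simp only: abs_le_iff) linarith
  qed
  then have "\<exists>l. g l = k" if "k \<in> {0..g j}" for k
    using nat_intermed_int_val[of i j g k] \<open>i \<le> j\<close> that by (auto simp: g_def)
  then have "{0..g j} \<subseteq> (\<lambda>v. (v - f i) div D) ` range f"
    by (force simp: g_def image_iff)
  then have "card {0..g j} \<le> card (range f)"
    using fin by (meson card_image_le card_mono finite_imageI le_trans)
  then have "g j + 1 \<le> int (card (range f))" by simp
  then have "(g j + 1) * D \<le> int (card (range f)) * D"
    using D by (intro mult_right_mono) auto
  moreover have "f j - f i = g j * D + (f j - f i) mod D" by (simp add: g_def)
  moreover have "(f j - f i) mod D < D" using D by simp
  ultimately show ?thesis by (simp add: algebra_simps)
qed

text \<open>Negating \<open>f\<close> keeps the step bound and the number of values, so the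
  one-sided estimate also bounds the descent.\<close>

lemma oscillation_le_card_range:
  fixes f :: "nat \<Rightarrow> int"
  assumes fin: "finite (range f)" and D: "D > 0" and step: "\<And>i. \<bar>f (Suc i) - f i\<bar> \<le> D"
  shows "\<bar>f j - f i\<bar> \<le> int (card (range f)) * D"
proof -
  have neg: "range (\<lambda>k. - f k) = uminus ` range f" by auto
  have card: "card (range (\<lambda>k. - f k)) = card (range f)"
    unfolding neg by (rule card_image) auto
  have up: "\<bar>f l - f k\<bar> \<le> int (card (range f)) * D" if "k \<le> l" for k l
  proof -
    have "\<bar>- f (Suc m) - - f m\<bar> \<le> D" for m using step[of m] by simp
    then have "- f l - - f k \<le> int (card (range f)) * D"
      using oscillation_le_card_range_aux[of "\<lambda>k. - f k" D k l] fin D that card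
      by (simp add: neg)
    with oscillation_le_card_range_aux[OF assms that] show ?thesis by simp
  qed
  show ?thesis
    using up[of i j] up[of j i] by (cases "i \<le> j") (auto simp: abs_minus_commute)
qed

lemma quasi_additive_mult:
  fixes P :: "nat \<Rightarrow> real"
  assumes "P 0 = 0" and quasi: "\<And>m n. \<bar>P (m + n) - P m - P n\<bar> \<le> C"
  shows "\<bar>P (m * n) - real m * P n\<bar> \<le> real m * C"
proof (induction m)
  case (Suc m)
  then show ?case using quasi[of n "m * n"] by (simp add: algebra_simps)
qed (use assms in simp)

text \<open>\<open>P\<close> is a quasimorphism on the naturals with defect at most
  \<open>C\<close>, and \<open>a\<close> is the value at \<open>1\<close> of its
  homogenization.\<close>

lemma quasi_additive_slope:
  fixes P :: "nat \<Rightarrow> real"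
  assumes "P 0 = 0" and quasi: "\<And>m n. \<bar>P (m + n) - P m - P n\<bar> \<le> C"
  obtains a where "(\<lambda>n. P n / real n) \<longlonglongrightarrow> a" and "\<And>n. \<bar>P n - real n * a\<bar> \<le> C"
proof -
  have C0: "C \<ge> 0" using quasi[of 0 0] by linarith
  have near: "\<bar>P n / n - P m / m\<bar> \<le> C / n + C / m" if "n > 0" "m > 0" for m n
  proof -
    \<comment> \<open>The number \<open>m * n\<close> consists of \<open>m\<close> blocks of size
      \<open>n\<close> and also of \<open>n\<close> blocks of size \<open>m\<close>, so this
      estimate is used once for each reading.\<close>
    have half: "\<bar>P (k * l) / (k * l) - P l / l\<bar> \<le> C / l" if "k > 0" "l > 0" for k l
    proof -
      have "P (k * l) / (k * l) - P l / l = (P (k * l) - k * P l) / (k * l)"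
        using that by (simp add: field_simps)
      also have "\<bar>\<dots>\<bar> \<le> k * C / (k * l)"
        using quasi_additive_mult[OF assms, of k l] unfolding abs_divide
        by (simp only: abs_mult abs_of_nat of_nat_mult) (intro divide_right_mono; simp)
      also have "\<dots> = C / l" using that by simp
      finally show ?thesis .
    qed
    show ?thesis
      using half[of m n] half[of n m] that by (simp add: mult.commute)
  qed
  have "Cauchy (\<lambda>n. P n / n)"
  proof (rule metric_CauchyI)
    fix e :: real assume "e > 0"
    obtain N :: nat where N: "2 * C / e < N" using reals_Archimedean2 by blast
    \<comment> \<open>Each of the two error terms in \<open>near\<close> gets half of
      \<open>e\<close>. Starting at \<open>Suc N\<close> makes the positivity of the index
      immediate.\<close>
    have small: "C / n < e / 2" if "n \<ge> Suc N" for n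
    proof -
      have "2 * C / e < n" using N that by linarith
      then show ?thesis using \<open>e > 0\<close> that by (simp add: field_simps)
    qed
    have "dist (P m / m) (P n / n) < e" if "m \<ge> Suc N" "n \<ge> Suc N" for m n
      using near[of m n] small[OF that(1)] small[OF that(2)] that unfolding dist_real_def by linarith
    then show "\<exists>N. \<forall>m\<ge>N. \<forall>n\<ge>N. dist (P m / m) (P n / n) < e" by blast
  qed
  then obtain a where a: "(\<lambda>n. P n / n) \<longlonglongrightarrow> a"
    using Cauchy_convergent convergentD by blast
  have "\<bar>P n - n * a\<bar> \<le> C" for n
  proof (cases "n = 0")
    case True
    then show ?thesis using assms(1) C0 by simp
  next
    case False
    \<comment> \<open>Letting \<open>m\<close> tend to infinity in \<open>near\<close> leaves only
      the error \<open>C / n\<close>, and multiplying by \<open>n\<close> makes it independent of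
      \<open>n\<close>.\<close>
    have "(\<lambda>m. \<bar>P n / n - P m / m\<bar>) \<longlonglongrightarrow> \<bar>P n / n - a\<bar>"
      by (intro tendsto_intros a)
    moreover have "(\<lambda>m. C / n + C / real m) \<longlonglongrightarrow> C / n + 0"
      by (intro tendsto_intros lim_const_over_n)
    ultimately have "\<bar>P n / n - a\<bar> \<le> C / n + 0"
      by (rule LIMSEQ_le) (use near False in \<open>auto intro!: exI[of _ 1]\<close>)
    then have "n * \<bar>P n / n - a\<bar> \<le> n * (C / n)"
      by (intro mult_left_mono) auto
    moreover have "P n - n * a = n * (P n / n - a)"
      using False by (simp add: right_diff_distrib)
    ultimately show ?thesis using False by (simp add: abs_mult)
  qed
  with a that show thesis by blast
qed

lemma sum_list_subsequence: "sum_list (\<omega> [i \<rightarrow> j]) = sum \<omega> {i..<j}"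
  for \<omega> :: "int word"
  by (simp add: subsequence_def sum_list_distinct_conv_sum_set)

lemma nonempty_factors_eq: "nonempty_factors \<omega> = {\<omega> [i \<rightarrow> i + n] | i n. n \<ge> 1}"
proof (intro equalityI subsetI)
  fix B assume "B \<in> nonempty_factors \<omega>"
  then obtain i j where "B = \<omega> [i \<rightarrow> j]" "i < j"
    unfolding nonempty_factors_def by blast
  then have "B = \<omega> [i \<rightarrow> i + (j - i)] \<and> j - i \<ge> 1" by simp
  then show "B \<in> {\<omega> [i \<rightarrow> i + n] | i n. n \<ge> 1}" by blast
next
  fix B assume "B \<in> {\<omega> [i \<rightarrow> i + n] | i n. n \<ge> 1}"
  then obtain i n where "B = \<omega> [i \<rightarrow> i + n]" "n \<ge> 1" by blast
  moreover from this have "i < i + n" by simp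
  ultimately show "B \<in> nonempty_factors \<omega>" unfolding nonempty_factors_def by blast
qed

lemma factors_of_length_eq:
  assumes "n \<ge> 1"
  shows "factors_of_length n \<omega> = range (\<lambda>i. \<omega> [i \<rightarrow> i + n])"
  using assms by (auto simp: factors_of_length_def nonempty_factors_eq)

text \<open>This puts the complexity in the form required by the oscillation bound: the range of an
  integer sequence indexed by the start of the window.\<close>

lemma additive_complexity_eq:
  assumes "n \<ge> 1"
  shows "additive_complexity \<omega> n = card (range (\<lambda>i. sum \<omega> {i..<i + n}))"
  by (simp add: additive_complexity_def factors_of_length_eq[OF assms] image_image
      sum_list_subsequence)

lemma slope_subsequence: "slope (\<omega> [i \<rightarrow> i + n]) = sum \<omega> {i..<i + n} / n"
  by (simp add: slope_def sum_list_subsequence)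

lemma slope_prefix: "slope (prefix n \<omega>) = sum \<omega> {..<n} / n"
  using slope_subsequence[of \<omega> 0 n] by (simp add: atLeast0LessThan)

lemma sum_window_Suc:
  fixes \<omega> :: "int word"
  shows "sum \<omega> {Suc i..<Suc i + n} - sum \<omega> {i..<i + n} = \<omega> (i + n) - \<omega> i"
  by (induction n) auto

text \<open>Multiplying by the length clears both denominators. Both directions of the theorem work
  with the resulting uniform bound on sums.\<close>

lemma factor_slopes_iff:
  "(\<forall>B \<in> nonempty_factors \<omega>. \<bar>slope B - a\<bar> \<le> real M / real (length B)) \<longleftrightarrow>
    (\<forall>n\<ge>1. \<forall>i. \<bar>sum \<omega> {i..<i + n} - n * a\<bar> \<le> M)"
proof -
  have "\<bar>slope (\<omega> [i \<rightarrow> i + n]) - a\<bar> \<le> M / length (\<omega> [i \<rightarrow> i + n]) \<longleftrightarrow>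
      \<bar>sum \<omega> {i..<i + n} - n * a\<bar> \<le> M" if "n \<ge> 1" for i n
  proof -
    have "slope (\<omega> [i \<rightarrow> i + n]) - a = (sum \<omega> {i..<i + n} - n * a) / n"
      using that by (simp add: slope_subsequence field_simps)
    then show ?thesis using that by (simp add: divide_le_cancel)
  qed
  then show ?thesis unfolding nonempty_factors_eq by blast
qed

lemma bounded_additive_complexity_imp_balanced:
  assumes "finite S" and "\<omega> \<in> infinite_words S" and "bounded_additive_complexity \<omega>"
  obtains C :: nat where "\<And>n i j. \<bar>sum \<omega> {j..<j + n} - sum \<omega> {i..<i + n}\<bar> \<le> int C"
proof -
  obtain M where M: "additive_complexity \<omega> n \<le> M" if "n \<ge> 1" for n
    using assms(3) unfolding bounded_additive_complexity_def by blast
  have \<omega>: "\<omega> i \<in> S" for i using assms(2) by (simp add: infinite_words_def)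
  define K where "K = (\<Sum>s\<in>S. \<bar>s\<bar>)"
  have K: "\<bar>\<omega> i\<bar> \<le> K" for i
    unfolding K_def using \<omega> assms(1) by (intro member_le_sum) auto
  then have K0: "K \<ge> 0" using K[of 0] by linarith
  \<comment> \<open>Sliding exchanges one letter for another, a change of at most
    \<open>2 * K\<close>. The \<open>+ 1\<close> keeps \<open>D\<close> positive even if all letters
    are \<open>0\<close>.\<close>
  define D where "D = 2 * K + 1"
  have "\<bar>sum \<omega> {j..<j + n} - sum \<omega> {i..<i + n}\<bar> \<le> int (M * nat D)" for n i j
  proof (cases "n \<ge> 1")
    case True
    define f where "f i = sum \<omega> {i..<i + n}" for i
    \<comment> \<open>This crude bound grows with \<open>n\<close> and serves only to make
      \<open>range f\<close> finite. The final constant depends on \<open>M\<close> and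
      \<open>D\<close> alone.\<close>
    have "\<bar>f i\<bar> \<le> n * K" for i
    proof -
      have "\<bar>f i\<bar> \<le> (\<Sum>k = i..<i + n. \<bar>\<omega> k\<bar>)" unfolding f_def by (rule sum_abs)
      also have "\<dots> \<le> n * K" using sum_bounded_above[of "{i..<i + n}" "\<lambda>k. \<bar>\<omega> k\<bar>" K] K by simp
      finally show ?thesis .
    qed
    then have "range f \<subseteq> {- (n * K)..n * K}" by (auto simp: abs_le_iff minus_le_iff)
    then have "finite (range f)" using finite_subset by blast
    moreover have "\<bar>f (Suc k) - f k\<bar> \<le> D" for k
      using K[of k] K[of "k + n"] unfolding f_def sum_window_Suc D_def by linarith
    ultimately have "\<bar>f j - f i\<bar> \<le> int (card (range f)) * D"
      using K0 by (intro oscillation_le_card_range) (auto simp: D_def)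
    also have "\<dots> \<le> int M * D"
      using M[OF True] K0 unfolding additive_complexity_eq[OF True] f_def D_def
      by (intro mult_right_mono) auto
    finally show ?thesis using K0 by (simp add: f_def D_def)
  qed simp
  with that show thesis by blast
qed

theorem theorem2p2:
  fixes S :: "int set" and \<omega> :: "int word"
  assumes "finite S" and "\<omega> \<in> infinite_words S"
  shows "bounded_additive_complexity \<omega> \<longleftrightarrow>
    slope_exists \<omega> \<and>
    (\<exists>M::nat. M \<ge> 1 \<and>
      (\<forall>B \<in> nonempty_factors \<omega>. \<bar>slope B - word_slope \<omega>\<bar> \<le> real M / real (length B)))"
proof
  assume "bounded_additive_complexity \<omega>"
  then obtain C :: nat
    where C: "\<And>n i j. \<bar>sum \<omega> {j..<j + n} - sum \<omega> {i..<i + n}\<bar> \<le> int C"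
    using bounded_additive_complexity_imp_balanced[OF assms] by blast
  define P where "P n = real_of_int (sum \<omega> {..<n})" for n
  \<comment> \<open>A prefix is the window starting at \<open>0\<close>, so balance compares any
    window with the prefix of its length. Splitting a longer prefix at \<open>m\<close> then gives
    quasi-additivity.\<close>
  have C_prefix: "\<bar>real_of_int (sum \<omega> {i..<i + n}) - P n\<bar> \<le> real C" for i n
    using C[of i n 0] unfolding P_def add_0 atLeast0LessThan
    by (metis of_int_abs of_int_diff of_int_le_iff of_int_of_nat_eq)
  have "\<bar>P (m + n) - P m - P n\<bar> \<le> real C" for m n
  proof -
    have "sum \<omega> {..<m + n} = sum \<omega> {..<m} + sum \<omega> {m..<m + n}"
      using sum.atLeastLessThan_concat[of 0 m "m + n" \<omega>] by (simp add: atLeast0LessThan)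
    then show ?thesis using C_prefix[of m n] by (simp add: P_def)
  qed
  moreover have "P 0 = 0" by (simp add: P_def)
  ultimately obtain a where a: "(\<lambda>n. P n / n) \<longlonglongrightarrow> a" and P: "\<And>n. \<bar>P n - n * a\<bar> \<le> C"
    using quasi_additive_slope[of P "real C"] by blast
  from a have lim: "(\<lambda>n. slope (prefix n \<omega>)) \<longlonglongrightarrow> a" by (simp add: slope_prefix P_def)
  then have slope: "word_slope \<omega> = a" unfolding word_slope_def by (rule limI)
  \<comment> \<open>One \<open>C\<close> takes the window to the prefix, the other takes the prefix
    to \<open>n * a\<close>. The \<open>+ 1\<close> ensures \<open>M \<ge> 1\<close> when
    \<open>C = 0\<close>.\<close>
  have "\<bar>sum \<omega> {i..<i + n} - n * a\<bar> \<le> real (2 * C + 1)" for n i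
    using P[of n] C_prefix[of i n] by simp
  then have "\<forall>B \<in> nonempty_factors \<omega>.
      \<bar>slope B - word_slope \<omega>\<bar> \<le> real (2 * C + 1) / real (length B)"
    unfolding slope factor_slopes_iff by blast
  moreover have "slope_exists \<omega>"
    using lim unfolding slope_exists_def by (rule convergentI)
  ultimately show "slope_exists \<omega> \<and> (\<exists>M::nat. M \<ge> 1 \<and>
      (\<forall>B \<in> nonempty_factors \<omega>. \<bar>slope B - word_slope \<omega>\<bar> \<le> real M / real (length B)))"
    by (intro conjI exI[of _ "2 * C + 1"]) auto
next
  define a where "a = word_slope \<omega>"
  assume "slope_exists \<omega> \<and> (\<exists>M::nat. M \<ge> 1 \<and>
      (\<forall>B \<in> nonempty_factors \<omega>. \<bar>slope B - word_slope \<omega>\<bar> \<le> real M / real (length B)))"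
  then obtain M :: nat where M: "\<And>n i. n \<ge> 1 \<Longrightarrow> \<bar>sum \<omega> {i..<i + n} - n * a\<bar> \<le> M"
    unfolding factor_slopes_iff a_def by blast
  have "additive_complexity \<omega> n \<le> 2 * M + 1" if "n \<ge> 1" for n
  proof -
    \<comment> \<open>Rounding the centre \<open>n * a\<close> up to an integer costs nothing,
      because \<open>s - M\<close> and \<open>s + M\<close> are integers on either side of it. The
      interval then holds exactly \<open>2 * M + 1\<close> integers.\<close>
    have "sum \<omega> {i..<i + n} \<in> {\<lceil>n * a\<rceil> - M..\<lceil>n * a\<rceil> + M}" for i
    proof -
      define s where "s = sum \<omega> {i..<i + n}"
      have "\<bar>s - n * a\<bar> \<le> M" using M[OF that, of i] by (simp add: s_def)
      then have "s - int M \<le> \<lceil>n * a\<rceil>" "\<lceil>n * a\<rceil> \<le> s + int M" by linarith+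
      then show ?thesis by (simp add: s_def)
    qed
    then have "range (\<lambda>i. sum \<omega> {i..<i + n}) \<subseteq> {\<lceil>n * a\<rceil> - M..\<lceil>n * a\<rceil> + M}"
      by blast
    then have "card (range (\<lambda>i. sum \<omega> {i..<i + n})) \<le> card {\<lceil>n * a\<rceil> - M..\<lceil>n * a\<rceil> + M}"
      by (intro card_mono) auto
    then show ?thesis by (simp add: additive_complexity_eq[OF that])
  qed
  then show "bounded_additive_complexity \<omega>"
    unfolding bounded_additive_complexity_def by (intro exI[of _ "2 * M + 1"]) auto
qed

end
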